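(* Let $k$ be a field of characteristic $\neq 2,3$ and $A$ a Jacobi-Jordan (JJ) algebra over $k$. Then there is a bijection $$\mathbb{GH}^2(A,k)\cong\mathcal{CF}(A)/\approx,$$ where $\approx$ is the following equivalence relation on $\mathcal{CF}(A)$: $(\lambda,\vartheta)\approx(\lambda',\vartheta')$ if and only if $\lambda=\lambda'$ and there exists a linear map $t:A\to k$ such that for any $a,b\in A$: $$\vartheta(a,b)=\vartheta'(a,b)+\lambda(a)t(b)+\lambda(b)t(a)-t(a\cdot b).$$
   Context: A JJ algebra is a $k$-vector space $A$ with a bilinear map $\cdot:A\times A\to A$ such that $a\cdot b=b\cdot a$ and $a\cdot(b\cdot c)+b\cdot(c\cdot a)+c\cdot(a\cdot b)=0$. $\mathcal{CF}(A)$ is the set of co-flag data of $A$: pairs $(\lambda,\vartheta)$ consisting of a linear map $\lambda:A\to k$ and a symmetric bilinear map $\vartheta:A\times A\to k$ such that for all $a,b,c\in A$: $\lambda(a\cdot b)=-2\lambda(a)\lambda(b)$ and $\vartheta(a,b\cdot c)+\vartheta(b,c\cdot a)+\vartheta(c,a\cdot b)+\lambda(a)\vartheta(b,c)+\lambda(b)\vartheta(c,a)+\lambda(c)\vartheta(a,b)=0$. For a vector space $V$, $\mathcal{CS}(A,V)$ is the set of crossed systems of $A$ by $V$: triples $(\triangleright,\vartheta,\cdot_V)$ of bilinear maps $\triangleright:A\times V\to V$, $\vartheta:A\times A\to V$, $\cdot_V:V\times V\to V$ such that $A\times V$ with multiplication $(a,x)\bullet(b,y):=(a\cdot b,\ \vartheta(a,b)+a\triangleright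 y+b\triangleright x+x\cdot_V y)$ is a JJ algebra. Two crossed systems are cohomologous, $(\triangleright,\vartheta,\cdot_V)\approx(\triangleright',\vartheta',\cdot_V')$, if $\cdot_V=\cdot_V'$ and there is a linear map $r:A\to V$ with $a\triangleright x=a\triangleright' x+r(a)\cdot_V' x$ and $\vartheta(a,b)=\vartheta'(a,b)+a\triangleright' r(b)+b\triangleright' r(a)+r(a)\cdot_V' r(b)-r(a\cdot b)$ for all $a,b\in A$, $x\in V$. $\mathbb{GH}^2(A,V):=\mathcal{CS}(A,V)/\approx$; here $V=k$. A co-flag datum $(\lambda,\vartheta)$ corresponds to the crossed system of $A$ by $k$ with $a\triangleright x=\lambda(a)x$, the same $\vartheta$, and zero multiplication on $k$. *)

theory Defs
  imports "HOL-Analysis.Product_Vector"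
begin

text \<open>
  A vector space over the field \<open>'k\<close> is a type together with a scalar multiplication satisfying
  the library locale \<^locale>\<open>vector_space\<close>; \<open>'k\<close> itself carries the scalar multiplication \<open>(*)\<close>.
\<close>

definition bilinear_map ::
    "('k::field \<Rightarrow> 'a::ab_group_add \<Rightarrow> 'a) \<Rightarrow> ('k \<Rightarrow> 'b::ab_group_add \<Rightarrow> 'b) \<Rightarrow>
     ('k \<Rightarrow> 'c::ab_group_add \<Rightarrow> 'c) \<Rightarrow> ('a \<Rightarrow> 'b \<Rightarrow> 'c) \<Rightarrow> bool" where
  "bilinear_map s1 s2 s3 f \<longleftrightarrow>
     (\<forall>x. Vector_Spaces.linear s2 s3 (\<lambda>y. f x y)) \<and> (\<forall>y. Vector_Spaces.linear s1 s3 (\<lambda>x. f x y))"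

locale jj_algebra = vector_space scale
  for scale :: "'k::field \<Rightarrow> 'a::ab_group_add \<Rightarrow> 'a" +
  fixes mult :: "'a \<Rightarrow> 'a \<Rightarrow> 'a"
  assumes bilinear_mult: "bilinear_map scale scale scale mult"
    and mult_commute: "mult a b = mult b a"
    and jacobi: "mult a (mult b c) + mult b (mult c a) + mult c (mult a b) = 0"

definition coflag_data ::
    "('k::field \<Rightarrow> 'a::ab_group_add \<Rightarrow> 'a) \<Rightarrow> ('a \<Rightarrow> 'a \<Rightarrow> 'a) \<Rightarrow>
     (('a \<Rightarrow> 'k) \<times> ('a \<Rightarrow> 'a \<Rightarrow> 'k)) set" where
  "coflag_data sA m = {(l, \<theta>).
     Vector_Spaces.linear sA (*) l \<and>
     bilinear_map sA sA (*) \<theta> \<and> (\<forall>a b. \<theta> a b = \<theta> b a) \<and>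
     (\<forall>a b. l (m a b) = - 2 * l a * l b) \<and>
     (\<forall>a b c. \<theta> a (m b c) + \<theta> b (m c a) + \<theta> c (m a b)
        + l a * \<theta> b c + l b * \<theta> c a + l c * \<theta> a b = 0)}"

definition coflag_equiv ::
    "('k::field \<Rightarrow> 'a::ab_group_add \<Rightarrow> 'a) \<Rightarrow> ('a \<Rightarrow> 'a \<Rightarrow> 'a) \<Rightarrow>
     (('a \<Rightarrow> 'k) \<times> ('a \<Rightarrow> 'a \<Rightarrow> 'k)) rel" where
  "coflag_equiv sA m = {((l, \<theta>), (l', \<theta>')).
     (l, \<theta>) \<in> coflag_data sA m \<and> (l', \<theta>') \<in> coflag_data sA m \<and> l = l' \<and>
     (\<exists>t. Vector_Spaces.linear sA (*) t \<and>
        (\<forall>a b. \<theta> a b = \<theta>' a b + l a * t b + l b * t a - t (m a b)))}"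

type_synonym ('a, 'v) crossed_triple = "('a \<Rightarrow> 'v \<Rightarrow> 'v) \<times> ('a \<Rightarrow> 'a \<Rightarrow> 'v) \<times> ('v \<Rightarrow> 'v \<Rightarrow> 'v)"

fun crossed_mult ::
    "('a \<Rightarrow> 'a \<Rightarrow> 'a) \<Rightarrow> ('a, 'v::ab_group_add) crossed_triple \<Rightarrow> 'a \<times> 'v \<Rightarrow> 'a \<times> 'v \<Rightarrow> 'a \<times> 'v" where
  "crossed_mult m (act, \<theta>, mV) (a, x) (b, y) = (m a b, \<theta> a b + act a y + act b x + mV x y)"

definition crossed_systems ::
    "('k::field \<Rightarrow> 'a::ab_group_add \<Rightarrow> 'a) \<Rightarrow> ('a \<Rightarrow> 'a \<Rightarrow> 'a) \<Rightarrow> ('k \<Rightarrow> 'v::ab_group_add \<Rightarrow> 'v) \<Rightarrow>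
     ('a, 'v) crossed_triple set" where
  "crossed_systems sA m sV = {(act, \<theta>, mV).
     bilinear_map sA sV sV act \<and> bilinear_map sA sA sV \<theta> \<and> bilinear_map sV sV sV mV \<and>
     jj_algebra (module_prod.scale sA sV) (crossed_mult m (act, \<theta>, mV))}"

definition cohomologous ::
    "('k::field \<Rightarrow> 'a::ab_group_add \<Rightarrow> 'a) \<Rightarrow> ('a \<Rightarrow> 'a \<Rightarrow> 'a) \<Rightarrow> ('k \<Rightarrow> 'v::ab_group_add \<Rightarrow> 'v) \<Rightarrow>
     ('a, 'v) crossed_triple rel" where
  "cohomologous sA m sV = {((act, \<theta>, mV), (act', \<theta>', mV')).
     (act, \<theta>, mV) \<in> crossed_systems sA m sV \<and> (act', \<theta>', mV') \<in> crossed_systems sA m sV \<and>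
     mV = mV' \<and>
     (\<exists>r. Vector_Spaces.linear sA sV r \<and>
        (\<forall>a x. act a x = act' a x + mV' (r a) x) \<and>
        (\<forall>a b. \<theta> a b = \<theta>' a b + act' a (r b) + act' b (r a) + mV' (r a) (r b) - r (m a b)))}"

lemma crossed_systems_mult_commute:
  assumes "(act, \<theta>, mV) \<in> crossed_systems sA m sV"
  shows "mV x y = mV y x"
proof -
  interpret jj_algebra "module_prod.scale sA sV" "crossed_mult m (act, \<theta>, mV)"
    using assms by (simp add: crossed_systems_def)
  have lin: "Vector_Spaces.linear sV sV (act 0)" "\<And>x. Vector_Spaces.linear sA sV (\<lambda>a. act a x)"
    using assms by (auto simp: crossed_systems_def bilinear_map_def)
  then have [simp]: "act 0 x = 0" for x
    using module_hom.zero[of sA sV "\<lambda>a. act a x"] by (simp add: linear_iff_module_hom)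
  show ?thesis
    using mult_commute[of "(0, x)" "(0, y)"] mult_commute[of "(0, 0)" "(0, 0)"] 
      assms by (auto simp: crossed_systems_def bilinear_map_def)
qed

lemma equiv_cohomologous: "equiv (crossed_systems sA m sV) (cohomologous sA m sV)"
proof (rule equivI)
  show "cohomologous sA m sV \<subseteq> crossed_systems sA m sV \<times> crossed_systems sA m sV"
    by (auto simp: cohomologous_def)
  show "refl_on (crossed_systems sA m sV) (cohomologous sA m sV)"
  proof (rule refl_onI)
    fix x assume x: "x \<in> crossed_systems sA m sV"
    obtain act \<theta> mV where [simp]: "x = (act, \<theta>, mV)" by (cases x)
    have b: "bilinear_map sA sV sV act" "bilinear_map sV sV sV mV"
      using x by (auto simp: crossed_systems_def)
    then have "Vector_Spaces.linear sA sV (\<lambda>a. act a 0)" by (simp add: bilinear_map_def)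
    then interpret p: vector_space_pair sA sV
      by (simp add: vector_space_pair_def Vector_Spaces.linear_def)
    have "act a 0 = 0" "mV 0 x = 0" for a x
      using b module_hom.zero[of sV sV "act a"] module_hom.zero[of sV sV "\<lambda>z. mV z x"]
      by (simp_all add: bilinear_map_def linear_iff_module_hom)
    then have "Vector_Spaces.linear sA sV (\<lambda>a. 0) \<and>
        (\<forall>a x. act a x = act a x + mV 0 x) \<and>
        (\<forall>a b. \<theta> a b = \<theta> a b + act a 0 + act b 0 + mV 0 0 - 0)"
      using p.linear_0 p.module_hom_zero by (simp add: linear_iff_module_hom)
    then show "(x, x) \<in> cohomologous sA m sV"
      using x by (auto simp: cohomologous_def intro!: exI[of _ "\<lambda>a. 0"])
  qed
  show "sym (cohomologous sA m sV)"
  proof (rule symI)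
    fix x y assume xy: "(x, y) \<in> cohomologous sA m sV"
    obtain act \<theta> mV where x: "x = (act, \<theta>, mV)" by (cases x)
    obtain act' \<theta>' mV' where y: "y = (act', \<theta>', mV')" by (cases y)
    obtain r where [simp]: "mV' = mV" and lr: "Vector_Spaces.linear sA sV r"
      and 1: "\<And>a x. act a x = act' a x + mV (r a) x"
      and 2: "\<And>a b. \<theta> a b = \<theta>' a b + act' a (r b) + act' b (r a) + mV (r a) (r b) - r (m a b)"
      and cs: "x \<in> crossed_systems sA m sV" "y \<in> crossed_systems sA m sV"
      using xy unfolding x y cohomologous_def by auto
    interpret p: vector_space_pair sA sV
      using lr by (simp add: vector_space_pair_def Vector_Spaces.linear_def)
    have lr': "Vector_Spaces.linear sA sV (\<lambda>a. - r a)"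
      using lr p.module_hom_neg by (simp add: linear_iff_module_hom)
    have b: "bilinear_map sA sV sV act'" "bilinear_map sV sV sV mV"
      using cs unfolding x y by (auto simp: crossed_systems_def)
    have n: "act' a (- z) = - act' a z" "mV (- z) x = - mV z x" "mV x (- z) = - mV x z" for a x z
      using b module_hom.neg[of sV sV "act' a" z] module_hom.neg[of sV sV "\<lambda>z. mV z x" z]
         module_hom.neg[of sV sV "mV x" z]
      by (simp_all add: bilinear_map_def linear_iff_module_hom)
    have "mV (r b) (r a) = mV (r a) (r b)" for a b
      using crossed_systems_mult_commute cs(2) unfolding y by fastforce
    then have "(\<forall>a x. act' a x = act a x + mV (- r a) x) \<and>
        (\<forall>a b. \<theta>' a b = \<theta> a b + act a (- r b) + act b (- r a) + mV (- r a) (- r b) - - r (m a b))"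
      by (simp add: 1 2 n)
    then show "(y, x) \<in> cohomologous sA m sV"
      using lr' cs unfolding x y cohomologous_def by (auto intro!: exI[of _ "\<lambda>a. - r a"])
  qed
  show "trans (cohomologous sA m sV)"
  proof (rule transI)
    fix x y z assume xy: "(x, y) \<in> cohomologous sA m sV" and yz: "(y, z) \<in> cohomologous sA m sV"
    obtain act \<theta> mV where x: "x = (act, \<theta>, mV)" by (cases x)
    obtain act' \<theta>' mV' where y: "y = (act', \<theta>', mV')" by (cases y)
    obtain act'' \<theta>'' mV'' where z: "z = (act'', \<theta>'', mV'')" by (cases z)
    obtain r where [simp]: "mV' = mV" and lr: "Vector_Spaces.linear sA sV r"
      and 1: "\<And>a x. act a x = act' a x + mV (r a) x"
      and 2: "\<And>a b. \<theta> a b = \<theta>' a b + act' a (r b) + act' b (r a) + mV (r a) (r b) - r (m a b)"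
      and cs: "x \<in> crossed_systems sA m sV"
      using xy unfolding x y cohomologous_def by auto
    obtain q where [simp]: "mV'' = mV" and lq: "Vector_Spaces.linear sA sV q"
      and 3: "\<And>a x. act' a x = act'' a x + mV (q a) x"
      and 4: "\<And>a b. \<theta>' a b = \<theta>'' a b + act'' a (q b) + act'' b (q a) + mV (q a) (q b) - q (m a b)"
      and cs': "z \<in> crossed_systems sA m sV"
      using yz unfolding y z cohomologous_def by auto
    interpret p: vector_space_pair sA sV
      using lr by (simp add: vector_space_pair_def Vector_Spaces.linear_def)
    have l: "Vector_Spaces.linear sA sV (\<lambda>a. r a + q a)"
      using lr lq p.module_hom_add by (simp add: linear_iff_module_hom)
    have b: "bilinear_map sA sV sV act''" "bilinear_map sV sV sV mV"
      using cs cs' unfolding x z by (auto simp: crossed_systems_def)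
    have n: "act'' a (u + v) = act'' a u + act'' a v" "mV (u + v) w = mV u w + mV v w"
        "mV w (u + v) = mV w u + mV w v" for a u v w
      using b module_hom.add[of sV sV "act'' a" u v] module_hom.add[of sV sV "\<lambda>z. mV z w" u v]
         module_hom.add[of sV sV "mV w" u v]
      by (simp_all add: bilinear_map_def linear_iff_module_hom)
    have "mV (q b) (r a) = mV (r a) (q b)" for a b
      using crossed_systems_mult_commute cs unfolding x by fastforce
    then have "(\<forall>a x. act a x = act'' a x + mV (r a + q a) x) \<and>
        (\<forall>a b. \<theta> a b = \<theta>'' a b + act'' a (r b + q b) + act'' b (r a + q a)
            + mV (r a + q a) (r b + q b) - (r (m a b) + q (m a b)))"
      by (simp add: 1 2 3 4 n algebra_simps)
    then show "(x, z) \<in> cohomologous sA m sV"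
      using l cs cs' unfolding x z cohomologous_def by (auto intro!: exI[of _ "\<lambda>a. r a + q a"])
  qed
qed

definition GH2 ::
    "('k::field \<Rightarrow> 'a::ab_group_add \<Rightarrow> 'a) \<Rightarrow> ('a \<Rightarrow> 'a \<Rightarrow> 'a) \<Rightarrow> ('k \<Rightarrow> 'v::ab_group_add \<Rightarrow> 'v) \<Rightarrow>
     ('a, 'v) crossed_triple set set" where
  "GH2 sA m sV = crossed_systems sA m sV // cohomologous sA m sV"

fun coflag_crossed ::
    "('a \<Rightarrow> 'k::field) \<times> ('a \<Rightarrow> 'a \<Rightarrow> 'k) \<Rightarrow> ('a, 'k) crossed_triple" where
  "coflag_crossed (l, \<theta>) = (\<lambda>a x. l a * x, \<theta>, \<lambda>x y. 0)"

end

theory Submission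
  imports Defs
begin

text \<open>
  A crossed system of \<open>A\<close> by \<open>k\<close> is already a co-flag datum. A bilinear product on \<open>k\<close> is
  \<open>x \<cdot> y = c x y\<close>, and the Jacobi identity at \<open>(0, 1)\<close> reads \<open>3 c\<^sup>2 = 0\<close>, so \<open>c = 0\<close>.
  The action is \<open>a \<triangleright> x = \<lambda>(a) x\<close>, and the Jacobi identity at \<open>(a, 0), (b, 0), (0, 1)\<close> and at
  \<open>(a, 0), (b, 0), (c, 0)\<close> gives the two conditions on \<open>(\<lambda>, \<vartheta>)\<close>. Under this bijection
  cohomologous systems correspond to equivalent data, because \<open>r\<close> disappears from the condition
  on the action once the product on \<open>k\<close> vanishes.
\<close>

text \<open>Serves to carry \<open>S\<close> back along \<open>f\<close>, so that \<open>R\<close>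
  inherits being an equivalence relation from \<open>S\<close>. The quotients then correspond by
  taking preimages of classes.\<close>

lemma bij_betw_quotient_pullback:
  assumes f: "bij_betw f A B" and S: "equiv B S"
    and R: "R \<subseteq> A \<times> A" "\<And>x y. x \<in> A \<Longrightarrow> y \<in> A \<Longrightarrow> (x, y) \<in> R \<longleftrightarrow> (f x, f y) \<in> S"
  shows "equiv A R"
    and "\<exists>g. bij_betw g (B // S) (A // R) \<and> (\<forall>x\<in>A. g (S `` {f x}) = R `` {x})"
proof -
  have fB: "f x \<in> B" if "x \<in> A" for x
    using f that by (auto simp: bij_betw_def)
  show equiv: "equiv A R"
  proof (rule equivI)
    show "R \<subseteq> A \<times> A" by (fact R)
    show "refl_on A R"
      using S R(2) fB by (auto simp: equiv_def refl_on_def)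
    show "sym R"
      using S R by (auto simp: equiv_def sym_def)
    show "trans R"
    proof (rule transI)
      fix x y z assume xyz: "(x, y) \<in> R" "(y, z) \<in> R"
      then have "x \<in> A" "y \<in> A" "z \<in> A" using R(1) by auto
      with xyz show "(x, z) \<in> R"
        using S R(2) unfolding equiv_def by (meson transD)
    qed
  qed
  \<comment> \<open>The preimage of a whole class involves no choice of representative, so
    \<open>g\<close> needs no well-definedness check.\<close>
  define g where "g X = {x \<in> A. f x \<in> X}" for X
  have g: "g (S `` {f x}) = R `` {x}" if "x \<in> A" for x
    using that R unfolding g_def by auto
  have class_cases: "\<exists>x\<in>A. X = S `` {f x}" if "X \<in> B // S" for X
    using that f by (auto simp: bij_betw_def elim!: quotientE)
  have "inj_on g (B // S)"
  proof (rule inj_onI)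
    fix X Y assume "X \<in> B // S" "Y \<in> B // S" and eq: "g X = g Y"
    then obtain x y where xy: "x \<in> A" "X = S `` {f x}" "y \<in> A" "Y = S `` {f y}"
      using class_cases by meson
    then have "(x, y) \<in> R"
      using eq g eq_equiv_class_iff[OF equiv] by simp
    then show "X = Y"
      using xy R(2) equiv_class_eq[OF S] by simp
  qed
  moreover have "g ` (B // S) = A // R"
  proof
    show "g ` (B // S) \<subseteq> A // R"
      using class_cases g by (fastforce intro: quotientI)
    show "A // R \<subseteq> g ` (B // S)"
    proof
      fix X assume "X \<in> A // R"
      then obtain x where "x \<in> A" "X = R `` {x}" by (rule quotientE)
      then show "X \<in> g ` (B // S)"
        using g[of x] quotientI[OF fB] by (intro image_eqI[of _ _ "S `` {f x}"]) auto
    qed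
  qed
  ultimately show "\<exists>g. bij_betw g (B // S) (A // R) \<and> (\<forall>x\<in>A. g (S `` {f x}) = R `` {x})"
    using g by (auto simp: bij_betw_def)
qed

lemma bilinear_map_iff:
  "bilinear_map s1 s2 s3 f \<longleftrightarrow>
    vector_space s1 \<and> vector_space s2 \<and> vector_space s3 \<and>
    (\<forall>x y z. f x (y + z) = f x y + f x z) \<and> (\<forall>x c y. f x (s2 c y) = s3 c (f x y)) \<and>
    (\<forall>x y z. f (x + y) z = f x z + f y z) \<and> (\<forall>x c y. f (s1 c x) y = s3 c (f x y))"
  unfolding bilinear_map_def Vector_Spaces.linear_iff by blast

lemma bilinear_map_zero:
  assumes "bilinear_map s1 s2 s3 f"
  shows "f 0 y = 0" "f x 0 = 0"
proof -
  have "f (0 + 0) y = f 0 y + f 0 y" "f x (0 + 0) = f x 0 + f x 0"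
    using assms unfolding bilinear_map_iff by blast+
  then show "f 0 y = 0" "f x 0 = 0" by simp_all
qed

lemma vector_space_field: "vector_space ((*) :: 'k::field \<Rightarrow> 'k \<Rightarrow> 'k)"
  by unfold_locales (simp_all add: algebra_simps)

lemma vector_space_prod_scale:
  assumes "vector_space s1" "vector_space s2"
  shows "vector_space (module_prod.scale s1 s2)"
    and "module_prod.scale s1 s2 c (a, x) = (s1 c a, s2 c x)"
proof -
  interpret vector_space_prod s1 s2
    using assms by (simp add: vector_space_prod_def vector_space_pair_def)
  show "vector_space (module_prod.scale s1 s2)" by (fact p.vector_space_axioms)
  show "module_prod.scale s1 s2 c (a, x) = (s1 c a, s2 c x)" by (fact scale_prod)
qed

text \<open>If 3 vanishes, the characteristic divides 3, hence is 1 or 3; characteristic 1 would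
  mean 1 = 0.\<close>

lemma three_neq_zero:
  assumes "CHAR('k::field) \<noteq> 3"
  shows "(3 :: 'k) \<noteq> 0"
proof
  assume "(3 :: 'k) = 0"
  then have "CHAR('k) dvd 3"
    using of_nat_eq_0_iff_char_dvd[where ?'a = 'k, of 3] by simp
  moreover have "n = 1 \<or> n = 3" if "n dvd 3" for n :: nat
    using dvd_imp_le[OF that] that by (cases "n = 0 \<or> n = 2") auto
  ultimately have "CHAR('k) = 1" using assms by blast
  then show False
    using of_nat_CHAR[where ?'a = 'k] by simp
qed

lemma coflag_crossed_in_crossed_systems:
  fixes scale :: "'k::field \<Rightarrow> 'a::ab_group_add \<Rightarrow> 'a"
  assumes jj: "jj_algebra scale mult" and d: "d \<in> coflag_data scale mult"
  shows "coflag_crossed d \<in> crossed_systems scale mult (*)"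
proof -
  obtain l \<theta> where [simp]: "d = (l, \<theta>)" by (cases d)
  interpret A: jj_algebra scale mult by (fact jj)
  have vs: "vector_space scale" by (fact A.vector_space_axioms)
  note prod = vector_space_prod_scale[OF vs vector_space_field]
  have lin: "l (a + b) = l a + l b" "l (scale c a) = c * l a"
    and \<theta>: "bilinear_map scale scale (*) \<theta>"
    and sym: "\<theta> a b = \<theta> b a" and lm: "l (mult a b) = - 2 * l a * l b"
    and cocycle: "\<theta> a (mult b c') + \<theta> b (mult c' a) + \<theta> c' (mult a b)
        + l a * \<theta> b c' + l b * \<theta> c' a + l c' * \<theta> a b = 0" for a b c c'
    using d by (auto simp: coflag_data_def Vector_Spaces.linear_iff)
  note bilin = A.bilinear_mult[unfolded bilinear_map_iff] \<theta>[unfolded bilinear_map_iff]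
  define M where "M = crossed_mult mult (\<lambda>a x. l a * x, \<theta>, \<lambda>x y. 0)"
  have M: "M (a, x) (b, y) = (mult a b, \<theta> a b + l a * y + l b * x)" for a x b y
    by (simp add: M_def)
  have "jj_algebra (module_prod.scale scale (*)) M"
  proof (intro jj_algebra.intro jj_algebra_axioms.intro)
    show "vector_space (module_prod.scale scale (*))" by (fact prod)
    show "bilinear_map (module_prod.scale scale (*)) (module_prod.scale scale (*))
        (module_prod.scale scale (*)) M"
      unfolding bilinear_map_iff
      using bilin prod by (auto simp: M lin algebra_simps)
    show "M u v = M v u" for u v
      by (cases u; cases v) (simp add: M A.mult_commute sym algebra_simps)
    show "M u (M v w) + M v (M w u) + M w (M u v) = 0" for u v w
    proof (cases u; cases v; cases w)
      fix a x b y c z assume [simp]: "u = (a, x)" "v = (b, y)" "w = (c, z)"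
      \<comment> \<open>In the second component the coefficient of \<open>z\<close> is
        \<open>l (mult a b) + 2 * l a * l b\<close>, which vanishes by \<open>lm\<close>; those of
        \<open>x\<close> and \<open>y\<close> vanish cyclically. The cocycle sum remains.\<close>
      have "M u (M v w) + M v (M w u) + M w (M u v) =
        (0, \<theta> a (mult b c) + \<theta> b (mult c a) + \<theta> c (mult a b)
          + l a * \<theta> b c + l b * \<theta> c a + l c * \<theta> a b)"
        using A.jacobi[of a b c] by (simp add: M lm algebra_simps)
      then show ?thesis by (simp add: cocycle zero_prod_def)
    qed
  qed
  moreover have "bilinear_map scale (*) (*) (\<lambda>a x. l a * x)"
    unfolding bilinear_map_iff using vs vector_space_field by (simp add: lin algebra_simps)
  moreover have "bilinear_map (*) (*) (*) (\<lambda>x y. 0 :: 'k)"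
    unfolding bilinear_map_iff using vector_space_field by simp
  ultimately show ?thesis
    using \<theta> by (simp add: crossed_systems_def M_def)
qed

text \<open>Gives surjectivity of \<open>coflag_crossed\<close>. Characteristic 3 has to be excluded
  because Jacobi there allows a nonzero product \<open>c * x * y\<close> on
  \<open>k\<close>.\<close>

lemma crossed_system_eq_coflag_crossed:
  fixes scale :: "'k::field \<Rightarrow> 'a::ab_group_add \<Rightarrow> 'a"
  assumes three: "(3 :: 'k) \<noteq> 0" and s: "s \<in> crossed_systems scale mult (*)"
  shows "\<exists>d \<in> coflag_data scale mult. coflag_crossed d = s"
proof -
  obtain act \<theta> mV where [simp]: "s = (act, \<theta>, mV)" by (cases s)
  define M where "M = crossed_mult mult (act, \<theta>, mV)"
  have act: "bilinear_map scale (*) (*) act" and \<theta>: "bilinear_map scale scale (*) \<theta>"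
    and mV: "bilinear_map (*) (*) (*) mV" and jj: "jj_algebra (module_prod.scale scale (*)) M"
    using s by (auto simp: crossed_systems_def M_def)
  interpret E: jj_algebra "module_prod.scale scale (*)" M by (fact jj)
  have M: "M (a, x) (b, y) = (mult a b, \<theta> a b + act a y + act b x + mV x y)" for a x b y
    by (simp add: M_def)
  note zero = bilinear_map_zero[OF act] bilinear_map_zero[OF \<theta>] bilinear_map_zero[OF mV]
  \<comment> \<open>A linear map on the one-dimensional space \<open>k\<close> is determined by its
    value at 1; the same principle gives \<open>mV_eq\<close> below.\<close>
  define l where "l a = act a 1" for a
  have act_eq: "act a x = l a * x" for a x
  proof -
    have "act a (x * 1) = x * act a 1"
      using act unfolding bilinear_map_iff by blast
    then show ?thesis by (simp add: l_def)
  qed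
  have l_zero: "l 0 = 0" by (simp add: l_def zero)
  have mV_eq: "mV x y = mV 1 1 * x * y" for x y
  proof -
    have "mV (x * 1) (y * 1) = x * (y * mV 1 1)"
      using mV unfolding bilinear_map_iff by metis
    then show ?thesis by simp
  qed
  \<comment> \<open>Bilinearity is available for \<open>M\<close>; the first component of its
    products with zero carries it over to \<open>mult\<close>.\<close>
  have mult_zero: "mult 0 a = 0" "mult a 0 = 0" for a
    using bilinear_map_zero[OF E.bilinear_mult, of "(a, 0)"] by (simp_all add: zero_prod_def M)
  have "3 * (mV 1 1)\<^sup>2 = 0"
  proof -
    \<comment> \<open>All three Jacobi terms coincide, and by \<open>mV_eq\<close> each is the
      square of \<open>mV 1 1\<close>.\<close>
    have "mV 1 (mV 1 1) + mV 1 (mV 1 1) + mV 1 (mV 1 1) = 0"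
      using E.jacobi[of "(0, 1)" "(0, 1)" "(0, 1)"] by (simp add: M mult_zero zero zero_prod_def)
    then show ?thesis
      by (simp add: mV_eq[of 1 "mV 1 1"] power2_eq_square)
  qed
  then have "mV 1 1 = 0" using three by simp
  then have mV_zero: "mV x y = 0" for x y
    using mV_eq[of x y] by simp
  have lin: "Vector_Spaces.linear scale (*) l"
    using act by (simp add: l_def[abs_def] bilinear_map_def)
  have sym: "\<theta> a b = \<theta> b a" for a b
    using E.mult_commute[of "(a, 0)" "(b, 0)"] by (simp add: M zero)
  have lm: "l (mult a b) = - 2 * l a * l b" for a b
  proof -
    \<comment> \<open>The last summand is the action of \<open>mult a b\<close> on 1; the
      accompanying term \<open>mV 1 (\<theta> a b)\<close> is removed by
      \<open>mV_zero\<close>.\<close>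
    have "l a * l b + l b * l a + l (mult a b) = 0"
      using E.jacobi[of "(a, 0)" "(b, 0)" "(0, 1)"]
      by (simp add: M mult_zero zero mV_zero zero_prod_def act_eq l_zero)
    then show ?thesis by algebra
  qed
  have cocycle: "\<theta> a (mult b c) + \<theta> b (mult c a) + \<theta> c (mult a b)
      + l a * \<theta> b c + l b * \<theta> c a + l c * \<theta> a b = 0" for a b c
    using E.jacobi[of "(a, 0)" "(b, 0)" "(c, 0)"]
    by (simp add: M zero zero_prod_def act_eq algebra_simps)
  have "(l, \<theta>) \<in> coflag_data scale mult"
    using lin \<theta> sym lm cocycle by (simp add: coflag_data_def)
  moreover have "coflag_crossed (l, \<theta>) = s"
    by (simp add: fun_eq_iff act_eq mV_zero)
  ultimately show ?thesis by blast
qed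

text \<open>Evaluating the action at 1 recovers \<open>l\<close>, while \<open>\<theta>\<close> is
  stored unchanged.\<close>

lemma inj_coflag_crossed: "inj coflag_crossed"
proof (rule injI)
  fix d d' :: "('a \<Rightarrow> 'b) \<times> ('a \<Rightarrow> 'a \<Rightarrow> 'b)"
  assume eq: "coflag_crossed d = coflag_crossed d'"
  obtain l \<theta> l' \<theta>' where [simp]: "d = (l, \<theta>)" "d' = (l', \<theta>')" by (cases d, cases d')
  have "(\<lambda>a x. l a * x) = (\<lambda>a x. l' a * x)"
    using eq by simp
  then have "l a * 1 = l' a * 1" for a
    by (rule fun_cong[THEN fun_cong])
  then show "d = d'" using eq by (auto simp: fun_eq_iff)
qed

text \<open>The same linear map serves as \<open>t\<close> and as \<open>r\<close>: with zero
  product on \<open>k\<close> the quadratic term \<open>mV' (r a) (r b)\<close> drops out, and the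
  two conditions on \<open>\<theta>\<close> agree.\<close>

lemma coflag_equiv_iff_cohomologous:
  fixes scale :: "'k::field \<Rightarrow> 'a::ab_group_add \<Rightarrow> 'a"
  assumes "jj_algebra scale mult"
    and "d \<in> coflag_data scale mult" "d' \<in> coflag_data scale mult"
  shows "(d, d') \<in> coflag_equiv scale mult \<longleftrightarrow>
    (coflag_crossed d, coflag_crossed d') \<in> cohomologous scale mult (*)"
proof -
  obtain l \<theta> l' \<theta>' where [simp]: "d = (l, \<theta>)" "d' = (l', \<theta>')" by (cases d, cases d')
  have "(\<forall>a x. l a * x = l' a * x) \<longleftrightarrow> l = l'"
    by (metis ext mult_cancel_left1 mult.right_neutral)
  then show ?thesis
    using assms coflag_crossed_in_crossed_systems[OF assms(1,2)]
      coflag_crossed_in_crossed_systems[OF assms(1,3)]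
    by (auto simp: coflag_equiv_def cohomologous_def)
qed

theorem proposition3p5:
  fixes scale :: "'k::field \<Rightarrow> 'a::ab_group_add \<Rightarrow> 'a"
    and mult :: "'a \<Rightarrow> 'a \<Rightarrow> 'a"
  assumes "CHAR('k) \<noteq> 2" and "CHAR('k) \<noteq> 3"
    and "jj_algebra scale mult"
  shows "equiv (coflag_data scale mult) (coflag_equiv scale mult) \<and>
    (\<exists>f. bij_betw f (GH2 scale mult ((*) :: 'k \<Rightarrow> 'k \<Rightarrow> 'k))
            (coflag_data scale mult // coflag_equiv scale mult) \<and>
         (\<forall>d \<in> coflag_data scale mult.
            f (cohomologous scale mult (*) `` {coflag_crossed d}) = coflag_equiv scale mult `` {d}))"
proof -
  have "coflag_crossed ` coflag_data scale mult = crossed_systems scale mult (*)"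
    using coflag_crossed_in_crossed_systems[OF assms(3)]
      crossed_system_eq_coflag_crossed[OF three_neq_zero[OF assms(2)]] by blast
  then have "bij_betw coflag_crossed (coflag_data scale mult) (crossed_systems scale mult (*))"
    using inj_coflag_crossed by (auto simp: bij_betw_def intro: inj_on_subset)
  \<comment> \<open>Here \<open>A\<close> is the set of co-flag data and \<open>B\<close> that of
    crossed systems, so the resulting bijection runs from \<open>GH2\<close> to the classes of
    co-flag data.\<close>
  note pullback = bij_betw_quotient_pullback[OF this equiv_cohomologous _
      coflag_equiv_iff_cohomologous[OF assms(3)]]
  have "coflag_equiv scale mult \<subseteq> coflag_data scale mult \<times> coflag_data scale mult"
    by (auto simp: coflag_equiv_def)
  from pullback[OF this] show ?thesis
    unfolding GH2_def by blast
qed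

end
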